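(* Let $\mathbb{F}_q$ be the finite field with $q$ elements, let $\mathcal{H}=\mathcal{H}(m,n,\mathcal{X},f)$ be the side information hypergraph of an instance $(m,n,\mathcal{X},f)$ of the index coding with side information (ICSI) problem, and let $\delta\ge 0$ be an integer. If $q\ge\kappa_q(\mathcal{H})+2\delta-1$, where $\kappa_q(\mathcal{H})$ is the min-rank of $\mathcal{H}$ over $\mathbb{F}_q$, then the length $\mathcal{N}_q(\mathcal{H},\delta)$ of an optimal linear $\delta$-error-correcting index code ($(\delta,\mathcal{H})$-ECIC) over $\mathbb{F}_q$ satisfies $$\mathcal{N}_q(\mathcal{H},\delta)=\kappa_q(\mathcal{H})+2\delta.$$
   Context: Notation: $[n]=\{1,\dots,n\}$; $\mathsf{wt}$ denotes Hamming weight; for $\boldsymbol{x}\in\mathbb{F}_q^n$ and $B\subseteq[n]$, $\boldsymbol{x}_B$ is the subvector of $\boldsymbol{x}$ indexed by $B$; $\boldsymbol{e}_j\in\mathbb{F}_q^n$ is the $j$th unit vector. Vectors are row vectors. ICSI instance: integers $m,n\ge 1$, subsets $\mathcal{X}_i\subseteq[n]$ for $i\in[m]$ with $\mathcal{X}=(\mathcal{X}_1,\dots,\mathcal{X}_m)$, and a map $f:[m]\to[n]$ with $f(i)\notin\mathcal{X}_i$ for all $i$. (Receiver $R_i$ knows $\boldsymbol{x}_{\mathcal{X}_i}$ and wants $x_{f(i)}$.) The side information hypergraph $\mathcal{H}(m,n,\mathcal{X},f)$ is the directed hypergraph with vertex set $[n]$ and edges $(f(i),\mathcal{X}_i)$,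 $i\in[m]$; it represents the instance. ECIC: a $\delta$-error-correcting index code ($(\delta,\mathcal{H})$-ECIC) over $\mathbb{F}_q$ of length $N$ is a map $\mathfrak{E}:\mathbb{F}_q^n\to\mathbb{F}_q^N$ such that for each $i\in[m]$ there is a map $\mathfrak{D}_i:\mathbb{F}_q^N\times\mathbb{F}_q^{|\mathcal{X}_i|}\to\mathbb{F}_q$ with $\mathfrak{D}_i(\mathfrak{E}(\boldsymbol{x})+\boldsymbol{\epsilon}_i,\boldsymbol{x}_{\mathcal{X}_i})=x_{f(i)}$ for all $\boldsymbol{x}\in\mathbb{F}_q^n$ and all $\boldsymbol{\epsilon}_i\in\mathbb{F}_q^N$ with $\mathsf{wt}(\boldsymbol{\epsilon}_i)\le\delta$. It is linear if $\mathfrak{E}(\boldsymbol{x})=\boldsymbol{x}\boldsymbol{L}$ for some $n\times N$ matrix $\boldsymbol{L}$ over $\mathbb{F}_q$. $\mathcal{N}_q(\mathcal{H},\delta)$ is the smallest length of a linear $(\delta,\mathcal{H})$-ECIC over $\mathbb{F}_q$; a linear code attaining it is called optimal. Min-rank: $\kappa_q(\mathcal{H})=\min\{\mathrm{rank}_{\mathbb{F}_q}(\{\boldsymbol{v}_i+\boldsymbol{e}_{f(i)}\}_{i\in[m]}) : \boldsymbol{v}_i\in\mathbb{F}_q^n,\ \mathrm{supp}(\boldsymbol{v}_i)\subseteq\mathcal{X}_i\text{ for all } i\in[m]\}$, where the rank of a family of vectors is the dimension of its span and $\mathrm{supp}(\boldsymbol{v})$ is the set of positions of nonzero entries. *)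

theory Defs
  imports "HOL-Library.FuncSet" "HOL-Library.Cardinality" "Jordan_Normal_Form.DL_Rank"
begin

(* All index ranges are 0-based: [n] is {..<n} and [m] is {..<m}. The fields are m, n, X and f
   of an ICSI instance; the side information hypergraph is the same data, with vertex set [n]
   and edges (demand H i, side_info H i) for i in [m], kept as a family indexed by i. *)
record icsi =
  receivers :: nat
  messages :: nat
  side_info :: "nat \<Rightarrow> nat set"
  demand :: "nat \<Rightarrow> nat"

definition icsi_instance :: "icsi \<Rightarrow> bool" where
  "icsi_instance H \<longleftrightarrow>
     receivers H \<ge> 1 \<and> messages H \<ge> 1 \<and>
     (\<forall>i<receivers H. side_info H i \<subseteq> {..<messages H} \<and>
        demand H i < messages H \<and> demand H i \<notin> side_info H i)"

definition supp :: "'a::zero vec \<Rightarrow> nat set" where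
  "supp v = {j. j < dim_vec v \<and> v $ j \<noteq> 0}"

definition wt :: "'a::zero vec \<Rightarrow> nat" where
  "wt v = card (supp v)"

definition subvec :: "'a vec \<Rightarrow> nat set \<Rightarrow> 'a vec" where
  "subvec x B = vec (card B) (\<lambda>j. x $ (sorted_list_of_set B ! j))"

definition ecic :: "icsi \<Rightarrow> nat \<Rightarrow> nat \<Rightarrow> ('a::field vec \<Rightarrow> 'a vec) \<Rightarrow> bool" where
  "ecic H \<delta> N E \<longleftrightarrow>
     E \<in> carrier_vec (messages H) \<rightarrow> carrier_vec N \<and>
     (\<forall>i<receivers H. \<exists>D :: 'a vec \<Rightarrow> 'a vec \<Rightarrow> 'a.
        \<forall>x\<in>carrier_vec (messages H). \<forall>\<epsilon>\<in>carrier_vec N.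
          wt \<epsilon> \<le> \<delta> \<longrightarrow> D (E x + \<epsilon>) (subvec x (side_info H i)) = x $ demand H i)"

(* The row vector product x L is the column product of the transpose of L with x. *)
definition linear_ecic :: "icsi \<Rightarrow> nat \<Rightarrow> nat \<Rightarrow> ('a::field vec \<Rightarrow> 'a vec) \<Rightarrow> bool" where
  "linear_ecic H \<delta> N E \<longleftrightarrow>
     ecic H \<delta> N E \<and>
     (\<exists>L\<in>carrier_mat (messages H) N.
        \<forall>x\<in>carrier_vec (messages H). E x = transpose_mat L *\<^sub>v x)"

definition opt_length :: "'a::field itself \<Rightarrow> icsi \<Rightarrow> nat \<Rightarrow> nat" where
  "opt_length TYPE('a) H \<delta> =
     (LEAST N. \<exists>E :: 'a vec \<Rightarrow> 'a vec. linear_ecic H \<delta> N E)"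

(* vec_space.rank is the dimension of the span of the columns, here the vectors of the family. *)
definition family_rank :: "nat \<Rightarrow> 'a::field vec list \<Rightarrow> nat" where
  "family_rank n vs = vec_space.rank n (mat_of_cols n vs)"

definition min_rank :: "'a::field itself \<Rightarrow> icsi \<Rightarrow> nat" where
  "min_rank TYPE('a) H =
     (LEAST r. \<exists>v :: nat \<Rightarrow> 'a vec.
        (\<forall>i<receivers H. v i \<in> carrier_vec (messages H) \<and> supp (v i) \<subseteq> side_info H i) \<and>
        r = family_rank (messages H)
              (map (\<lambda>i. v i + unit_vec (messages H) (demand H i)) [0..<receivers H]))"

end

(* A linear map L is a delta-error-correcting index code iff wt(zL) > 2 delta whenever z vanishes
   on X_i but not at f(i), for some i. Composing a realisation of the min-rank kappa with an
   extended Reed-Solomon code of length kappa + 2 delta gives such an L: if wt(zL) <= 2 delta then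
   z is orthogonal to all v_i + e_{f(i)}, so z_{f(i)} = 0 once z vanishes on X_i. Conversely, after
   deleting 2 delta columns of L, zL is still nonzero for all those z, hence by duality e_{f(i)}
   lies in the span of the remaining columns and the e_j with j in X_i; this exhibits vectors
   v_i + e_{f(i)} in a space of dimension at most N - 2 delta. *)

theory Submission
  imports Defs "HOL-Computational_Algebra.Polynomial"
begin

section \<open>Rank as the length of a factorization\<close>

text \<open>A maximal independent set of columns spans all columns and has \<open>rank A\<close>
  elements. Its enumeration is \<open>b\<close>, and the coordinates of a column \<open>v\<close> in
  it are \<open>c v\<close>. Writing this with indexed sums lets later arguments swap
  summations.\<close>

lemma (in vec_space) rank_factorization:
  assumes A: "A \<in> carrier_mat n nc"
  shows "\<exists>b c. \<forall>v\<in>set (cols A). \<forall>j<n. v $ j = (\<Sum>t<rank A. c v t * b t j)"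
proof -
  have colsA: "set (cols A) \<subseteq> carrier_vec n"
    using A cols_dim by blast
  \<comment> \<open>The empty set is the seed that is extended to a maximal independent set of
    columns.\<close>
  have "lin_indpt {}"
    by (metis empty_subsetI fin_dim finite_basis_exists subset_li_is_li vec_vs vectorspace.basis_def)
  then obtain S where finS: "finite S"
    and max: "maximal S (\<lambda>T. T \<subseteq> set (cols A) \<and> lin_indpt T)"
    using maximal_exists_superset[of "set (cols A)" "\<lambda>T. T \<subseteq> set (cols A) \<and> lin_indpt T" "{}"]
    by auto
  have S: "S \<subseteq> set (cols A)" "lin_indpt S"
    using max by (auto simp: maximal_def)
  have Scar: "S \<subseteq> carrier_vec n"
    using S colsA by auto
  have rank: "rank A = card S"
    by (rule rank_card_indpt[OF A max])
  have "v \<in> span S" if "v \<in> set (cols A)" for v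
  proof (rule ccontr)
    assume v: "v \<notin> span S"
    have "v \<notin> S"
      using v Scar span_mem by auto
    have "lin_indpt (insert v S)"
      using lin_dep_iff_in_span[of S v] v S Scar \<open>v \<notin> S\<close> that colsA by auto
    then have "insert v S = S"
      using max that S unfolding maximal_def by (metis insert_subset subset_insertI)
    then show False
      using \<open>v \<notin> S\<close> by blast
  qed
  then have "\<forall>v\<in>set (cols A). \<exists>a. v = lincomb a S"
    using finite_span[OF finS] Scar by auto
  then obtain a where a: "\<And>v. v \<in> set (cols A) \<Longrightarrow> v = lincomb (a v) S"
    by metis
  obtain h where h: "bij_betw h {..<card S} S"
    using ex_bij_betw_nat_finite[OF finS] by (auto simp: atLeast0LessThan)
  have "v $ j = (\<Sum>t<rank A. a v (h t) * h t $ j)" if "v \<in> set (cols A)" "j < n" for v j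
  proof -
    have "v $ j = lincomb (a v) S $ j"
      using a that by metis
    also have "\<dots> = (\<Sum>x\<in>S. a v x * x $ j)"
      by (rule lincomb_index[OF that(2) Scar])
    also have "\<dots> = (\<Sum>t<rank A. a v (h t) * h t $ j)"
      unfolding rank by (rule sum.reindex_bij_betw[OF h, symmetric])
    finally show ?thesis .
  qed
  then show ?thesis
    by (intro exI[of _ "\<lambda>t j. h t $ j"] exI[of _ "\<lambda>v t. a v (h t)"]) simp
qed

text \<open>Converse to the factorization: the columns lie in the span of the \<open>r\<close>
  vectors \<open>b t\<close>, which has dimension at most \<open>r\<close>.\<close>

lemma (in vec_space) rank_le_factorization:
  fixes b :: "nat \<Rightarrow> nat \<Rightarrow> 'a"
  assumes A: "A \<in> carrier_mat n nc"
    and fact: "\<And>v. v \<in> set (cols A) \<Longrightarrow> \<exists>c. \<forall>j<n. v $ j = (\<Sum>t<r. c t * b t j)"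
  shows "rank A \<le> r"
proof -
  have colsA: "set (cols A) \<subseteq> carrier_vec n"
    using A cols_dim by blast
  \<comment> \<open>The vectors \<open>b t\<close> become the columns of \<open>B\<close>, so that a
    column of \<open>A\<close> with coefficients \<open>c\<close> is the product of \<open>B\<close>
    with \<open>c\<close>.\<close>
  define B where "B = mat n r (\<lambda>(j, t). b t j)"
  have B: "B \<in> carrier_mat n r"
    by (simp add: B_def)
  have "set (cols A) \<subseteq> span (set (cols B))"
  proof
    fix v assume v: "v \<in> set (cols A)"
    obtain c where c: "\<And>j. j < n \<Longrightarrow> v $ j = (\<Sum>t<r. c t * b t j)"
      using fact[OF v] by blast
    have "v = B *\<^sub>v vec r c"
    proof (rule eq_vecI)
      fix j assume "j < dim_vec (B *\<^sub>v vec r c)"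
      then have j: "j < n"
        by (simp add: B_def)
      show "v $ j = (B *\<^sub>v vec r c) $ j"
        using j by (simp add: c B_def scalar_prod_def mult.commute atLeast0LessThan)
    qed (use v colsA in \<open>auto simp: B_def\<close>)
    moreover have "lincomb_list c (cols B) = mat_of_cols n (cols B) *\<^sub>v vec (length (cols B)) c"
      using B cols_dim[of B] by (intro lincomb_list_as_mat_mult) auto
    ultimately have "v = lincomb_list c (cols B)"
      using B mat_of_cols_cols[of B] by simp
    then have "v \<in> span_list (cols B)"
      by (intro in_span_listI[where c = c]) auto
    then show "v \<in> span (set (cols B))"
      using span_list_as_span B cols_dim[of B] by auto
  qed
  have Bcar: "set (cols B) \<subseteq> carrier_vec n"
    using B cols_dim by blast
  have subA: "subspace class_ring (span (set (cols A))) V"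
    and subB: "subspace class_ring (span (set (cols B))) V"
    using colsA Bcar by (auto intro!: span_is_subspace)
  have "span (set (cols A)) \<subseteq> span (set (cols B))"
    using \<open>set (cols A) \<subseteq> span (set (cols B))\<close> Bcar by (intro span_subsetI) auto
  then have "subspace class_ring (span (set (cols A))) (vs (span (set (cols B))))"
    by (rule nested_subspaces[OF subB subA])
  then have "rank A \<le> rank B"
    unfolding rank_def
    using vectorspace.subspace_dim[OF subspace_is_vs[OF subB]] fin_dim_span_cols[OF A] fin_dim_span_cols[OF B]
    by auto
  then show ?thesis
    using rank_le_nc[OF B] by simp
qed

section \<open>Duality for finitely many linear functionals\<close>

text \<open>Read \<open>g i\<close> and \<open>h\<close> as functionals on vectors of length
  \<open>n\<close>. Induction on the number of functionals: one functional at a time is either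
  redundant on the common kernel of the others or has a forced coefficient that can be subtracted
  from \<open>h\<close>.\<close>

lemma combination_of_common_kernel:
  fixes g :: "'i \<Rightarrow> nat \<Rightarrow> 'a::field"
  assumes "finite I"
    and "\<And>z. (\<And>i. i \<in> I \<Longrightarrow> (\<Sum>j<n. z j * g i j) = 0) \<Longrightarrow> (\<Sum>j<n. z j * h j) = 0"
  shows "\<exists>c. \<forall>j<n. h j = (\<Sum>i\<in>I. c i * g i j)"
  using assms
proof (induction I arbitrary: h rule: finite_induct)
  case empty
  have "h k = 0" if "k < n" for k
    using empty[of "\<lambda>j. if j = k then 1 else 0"] that by (simp add: if_distrib if_distribR cong: if_cong)
  then show ?case
    by simp
next
  case (insert i I)
  show ?case
  proof (cases "\<exists>z. (\<forall>k\<in>I. (\<Sum>j<n. z j * g k j) = 0) \<and> (\<Sum>j<n. z j * g i j) \<noteq> 0")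
    \<comment> \<open>Here \<open>g i\<close> already vanishes on the common kernel of the others,
      so it adds no constraint and receives coefficient 0.\<close>
    case False
    then have "(\<Sum>j<n. z j * h j) = 0" if "\<And>k. k \<in> I \<Longrightarrow> (\<Sum>j<n. z j * g k j) = 0" for z
      using that by (intro insert.prems) auto
    then obtain c where c: "\<forall>j<n. h j = (\<Sum>k\<in>I. c k * g k j)"
      using insert.IH by blast
    have "(\<Sum>k\<in>insert i I. (c(i := 0)) k * g k j) = (\<Sum>k\<in>I. c k * g k j)" for j
      using insert.hyps by (auto intro!: sum.cong)
    then show ?thesis
      using c by (intro exI[of _ "c(i := 0)"]) (auto simp del: fun_upd_apply)
  next
    case True
    then obtain z0 where z0: "\<And>k. k \<in> I \<Longrightarrow> (\<Sum>j<n. z0 j * g k j) = 0"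
      and ne: "(\<Sum>j<n. z0 j * g i j) \<noteq> 0" by auto
    \<comment> \<open>The only possible coefficient of \<open>g i\<close>, since all other
      functionals vanish at \<open>z0\<close>.\<close>
    define \<alpha> where "\<alpha> = (\<Sum>j<n. z0 j * h j) / (\<Sum>j<n. z0 j * g i j)"
    have "(\<Sum>j<n. z j * (h j - \<alpha> * g i j)) = 0"
      if z: "\<And>k. k \<in> I \<Longrightarrow> (\<Sum>j<n. z j * g k j) = 0" for z
    proof -
      \<comment> \<open>Subtracting \<beta> times \<open>z0\<close> from \<open>z\<close> puts it
        into the kernel of \<open>g i\<close> without leaving the kernels of the others.\<close>
      define \<beta> where "\<beta> = (\<Sum>j<n. z j * g i j) / (\<Sum>j<n. z0 j * g i j)"
      have lin: "(\<Sum>j<n. (z j - \<beta> * z0 j) * w j) = (\<Sum>j<n. z j * w j) - \<beta> * (\<Sum>j<n. z0 j * w j)" for w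
        by (simp add: left_diff_distrib sum_subtractf sum_distrib_left mult.assoc)
      have "(\<Sum>j<n. (z j - \<beta> * z0 j) * g k j) = 0" if "k \<in> insert i I" for k
        unfolding lin using that by (auto simp: z z0 \<beta>_def ne)
      then have "(\<Sum>j<n. (z j - \<beta> * z0 j) * h j) = 0"
        by (rule insert.prems)
      then have "(\<Sum>j<n. z j * h j) = \<beta> * (\<Sum>j<n. z0 j * h j)"
        by (simp add: lin)
      also have "\<dots> = \<alpha> * (\<Sum>j<n. z j * g i j)"
        by (simp add: \<alpha>_def \<beta>_def)
      finally show ?thesis
        by (simp add: right_diff_distrib sum_subtractf sum_distrib_left mult.left_commute)
    qed
    then obtain c where c: "\<forall>j<n. h j - \<alpha> * g i j = (\<Sum>k\<in>I. c k * g k j)"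
      using insert.IH[of "\<lambda>j. h j - \<alpha> * g i j"] by blast
    have "(\<Sum>k\<in>insert i I. (c(i := \<alpha>)) k * g k j) = \<alpha> * g i j + (\<Sum>k\<in>I. c k * g k j)" for j
      using insert.hyps by (auto intro!: sum.cong)
    then show ?thesis
      using c by (intro exI[of _ "c(i := \<alpha>)"]) (auto simp del: fun_upd_apply simp: algebra_simps)
  qed
qed

section \<open>The extended Reed-Solomon code\<close>

text \<open>The extended Reed--Solomon code: the point at infinity \<open>None\<close> reads off the coefficient
  of degree \<open>k - 1\<close>, whose vanishing lowers the degree bound by one.\<close>

lemma extended_reed_solomon:
  assumes "N \<le> CARD('a::{field,finite}) + 1"
  shows "\<exists>ev :: nat \<Rightarrow> nat \<Rightarrow> 'a.
    \<forall>y. k \<le> card {s. s < N \<and> (\<Sum>t<k. y t * ev s t) = 0} \<longrightarrow> (\<forall>t<k. y t = 0)"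
proof -
  \<comment> \<open>The code positions are distinct points of the projective line, which has one
    point more than the field; this is the source of the bound \<open>CARD('a) + 1\<close>.\<close>
  have "card {..<N} \<le> card (UNIV :: 'a option set)"
    using assms by (simp add: card_UNIV_option)
  then obtain p :: "nat \<Rightarrow> 'a option" where p: "inj_on p {..<N}"
    using card_le_inj[of "{..<N}" "UNIV :: 'a option set"] by auto
  define ev where "ev s t = (case p s of None \<Rightarrow> if t = k - 1 then 1 else 0 | Some a \<Rightarrow> a ^ t)" for s t
  have zero: "y t = 0" if big: "k \<le> card {s. s < N \<and> (\<Sum>t<k. y t * ev s t) = 0}" and t: "t < k" for y t
  proof (rule ccontr)
    assume yt: "y t \<noteq> 0"
    \<comment> \<open>With the message as coefficients, a zero coordinate of the codeword is a root
      of \<open>P\<close> or the vanishing of its coefficient at infinity.\<close>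
    define P where "P = (\<Sum>t<k. monom (y t) t)"
    have coeffP: "coeff P u = (if u < k then y u else 0)" for u
      by (auto simp: P_def coeff_sum)
    have P0: "P \<noteq> 0"
      using coeffP[of t] t yt by auto
    have evP: "(\<Sum>t<k. y t * ev s t) = (case p s of None \<Rightarrow> coeff P (k - 1) | Some a \<Rightarrow> poly P a)" for s
    proof (cases "p s")
      case None
      then have "(\<Sum>t<k. y t * ev s t) = (\<Sum>t<k. if t = k - 1 then y t else 0)"
        by (intro sum.cong) (auto simp: ev_def)
      then show ?thesis
        using t None by (simp add: coeffP)
    next
      case (Some a)
      then show ?thesis
        by (simp add: ev_def P_def poly_sum poly_monom)
    qed
    define Z where "Z = {s. s < N \<and> (\<Sum>t<k. y t * ev s t) = 0}"
    have degP: "degree P \<le> k - 1"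
      using t by (intro degree_le) (auto simp: coeffP)
    have roots: "card {a. poly P a = 0} \<le> degree P"
      by (rule card_poly_roots_bound[OF P0])
    have Z: "card (p ` Z) = card Z"
      using p by (intro card_image inj_on_subset[OF p]) (auto simp: Z_def)
    have "card Z < k"
    proof (cases "coeff P (k - 1) = 0")
      case True
      \<comment> \<open>Infinity may count as a zero here, but the degree then drops below
        \<open>k - 1\<close>, which leaves at most \<open>k - 2\<close> roots.\<close>
      then have "degree P \<noteq> k - 1"
        using P0 by (metis leading_coeff_0_iff)
      then have "degree P < k - 1"
        using degP by simp
      have "p s \<in> insert None (Some ` {a. poly P a = 0})" if "s \<in> Z" for s
        using that by (cases "p s") (auto simp: Z_def evP)
      then have "p ` Z \<subseteq> insert None (Some ` {a. poly P a = 0})"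
        by (rule image_subsetI)
      then have "card (p ` Z) \<le> card (insert None (Some ` {a. poly P a = 0}))"
        by (intro card_mono) auto
      also have "\<dots> = Suc (card {a. poly P a = 0})"
        by (simp add: card_image card_insert_if image_iff)
      finally show ?thesis
        using Z roots \<open>degree P < k - 1\<close> by linarith
    next
      case False
      \<comment> \<open>Infinity is not a zero now, so all zeros are among the at most
        \<open>k - 1\<close> roots.\<close>
      have "p s \<in> Some ` {a. poly P a = 0}" if "s \<in> Z" for s
        using that False by (cases "p s") (auto simp: Z_def evP)
      then have "p ` Z \<subseteq> Some ` {a. poly P a = 0}"
        by (rule image_subsetI)
      then have "card (p ` Z) \<le> card (Some ` {a. poly P a = 0})"
        by (intro card_mono) auto
      also have "\<dots> = card {a. poly P a = 0}"
        by (simp add: card_image)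
      finally show ?thesis
        using Z roots degP t by linarith
    qed
    then show False
      using big by (simp add: Z_def)
  qed
  show ?thesis
  proof (intro exI allI impI)
    fix y t assume "k \<le> card {s. s < N \<and> (\<Sum>t<k. y t * ev s t) = 0}" "t < k"
    then show "y t = 0"
      by (rule zero[of y t])
  qed
qed

section \<open>Hamming weight and the decodability criterion\<close>

lemma finite_supp [simp]: "finite (supp v)"
  by (simp add: supp_def)

lemma wt_minus_le:
  fixes v w :: "'a::group_add vec"
  assumes "v \<in> carrier_vec N" "w \<in> carrier_vec N"
  shows "wt (v - w) \<le> wt v + wt w"
proof -
  have "supp (v - w) \<subseteq> supp v \<union> supp w"
    using assms by (auto simp: supp_def)
  then have "card (supp (v - w)) \<le> card (supp v \<union> supp w)"
    by (intro card_mono) auto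
  also have "\<dots> \<le> card (supp v) + card (supp w)"
    by (rule card_Un_le)
  finally show ?thesis
    by (simp add: wt_def)
qed

text \<open>Two error words of weight at most \<delta> can make the codewords 0 and \<open>w\<close>
  indistinguishable: one keeps \<delta> of the nonzero entries of \<open>w\<close>, the other
  cancels the rest.\<close>

lemma split_wt_le_double:
  fixes w :: "'a::group_add vec"
  assumes w: "w \<in> carrier_vec N" and wt: "wt w \<le> 2 * \<delta>"
  obtains v v' where "v \<in> carrier_vec N" "v' \<in> carrier_vec N" "wt v \<le> \<delta>" "wt v' \<le> \<delta>" "w + v = v'"
proof -
  \<comment> \<open>The minimum covers the case where \<open>w\<close> has fewer than \<delta>
    nonzero entries.\<close>
  obtain S where S: "S \<subseteq> supp w" "card S = min \<delta> (wt w)"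
    using obtain_subset_with_card_n[of "min \<delta> (wt w)" "supp w"] by (auto simp: wt_def)
  define v where "v = vec N (\<lambda>j. if j \<in> S then 0 else - (w $ j))"
  define v' where "v' = vec N (\<lambda>j. if j \<in> S then w $ j else 0)"
  have "supp v \<subseteq> supp w - S"
    using w by (auto simp: supp_def v_def split: if_splits)
  then have "wt v \<le> card (supp w - S)"
    unfolding wt_def by (intro card_mono) auto
  also have "\<dots> = wt w - min \<delta> (wt w)"
    using S by (subst card_Diff_subset) (auto simp: wt_def intro: finite_subset)
  finally have "wt v \<le> \<delta>"
    using wt by linarith
  have "supp v' \<subseteq> S"
    by (auto simp: supp_def v'_def split: if_splits)
  then have "wt v' \<le> card S"
    unfolding wt_def using S by (intro card_mono) (auto intro: finite_subset)
  then have "wt v' \<le> \<delta>"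
    using S by simp
  show thesis
    by (rule that[of v v']) (use w \<open>wt v \<le> \<delta>\<close> \<open>wt v' \<le> \<delta>\<close> in \<open>auto simp: v_def v'_def\<close>)
qed

lemma subvec_eq_iff:
  assumes "finite B"
  shows "subvec x B = subvec y B \<longleftrightarrow> (\<forall>j\<in>B. x $ j = y $ j)"
proof -
  have "subvec x B = subvec y B \<longleftrightarrow>
      (\<forall>k<card B. x $ (sorted_list_of_set B ! k) = y $ (sorted_list_of_set B ! k))"
    by (auto simp: subvec_def vec_eq_iff)
  also have "\<dots> \<longleftrightarrow> (\<forall>j\<in>set (sorted_list_of_set B). x $ j = y $ j)"
    by (simp add: all_set_conv_all_nth)
  finally show ?thesis
    using assms by simp
qed

text \<open>Decoding fails for a receiver exactly if two messages with the same side information and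
  different demands can be received as one word. By linearity only their difference \<open>z\<close>
  matters, and the error balls of radius \<delta> meet iff the codeword of \<open>z\<close> has
  weight at most 2 \<delta>.\<close>

lemma ecic_linear_iff:
  fixes L :: "'a::field mat"
  assumes inst: "icsi_instance H" and L: "L \<in> carrier_mat (messages H) N"
    and E: "\<And>x. x \<in> carrier_vec (messages H) \<Longrightarrow> E x = transpose_mat L *\<^sub>v x"
  shows "ecic H \<delta> N E \<longleftrightarrow>
    (\<forall>i<receivers H. \<forall>z\<in>carrier_vec (messages H).
       (\<forall>j\<in>side_info H i. z $ j = 0) \<longrightarrow> wt (transpose_mat L *\<^sub>v z) \<le> 2 * \<delta> \<longrightarrow> z $ demand H i = 0)"
    (is "_ \<longleftrightarrow> ?R")
proof -
  let ?n = "messages H"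
  have LT: "transpose_mat L \<in> carrier_mat N ?n"
    using L by simp
  have side: "side_info H i \<subseteq> {..<?n}" "demand H i < ?n" "finite (side_info H i)" if "i < receivers H" for i
    using inst that finite_subset unfolding icsi_instance_def by auto
  show ?thesis
  proof
    assume ecic: "ecic H \<delta> N E"
    show ?R
    proof (intro allI ballI impI)
      fix i z assume i: "i < receivers H" and z: "z \<in> carrier_vec ?n"
        and z0: "\<forall>j\<in>side_info H i. z $ j = 0" and wt: "wt (transpose_mat L *\<^sub>v z) \<le> 2 * \<delta>"
      obtain D where D: "\<And>x \<epsilon>. \<lbrakk>x \<in> carrier_vec ?n; \<epsilon> \<in> carrier_vec N; wt \<epsilon> \<le> \<delta>\<rbrakk>
          \<Longrightarrow> D (E x + \<epsilon>) (subvec x (side_info H i)) = x $ demand H i"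
        using ecic i unfolding ecic_def by metis
      obtain v v' where v: "v \<in> carrier_vec N" "v' \<in> carrier_vec N" "wt v \<le> \<delta>" "wt v' \<le> \<delta>"
          "transpose_mat L *\<^sub>v z + v = v'"
        using split_wt_le_double[OF mult_mat_vec_carrier[OF LT z] wt] .
      \<comment> \<open>The messages \<open>z\<close> and 0 now give the decoder identical input, so
        their demanded entries agree.\<close>
      have "E z + v = E (0\<^sub>v ?n) + v'"
        using v LT L by (auto simp: E z scalar_prod_def)
      moreover have "subvec z (side_info H i) = subvec (0\<^sub>v ?n) (side_info H i)"
        using z0 side[OF i] by (auto simp: subvec_eq_iff)
      ultimately have "z $ demand H i = 0\<^sub>v ?n $ demand H i"
        using D[OF z v(1,3)] D[OF zero_carrier_vec v(2,4)] by simp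
      then show "z $ demand H i = 0"
        using side[OF i] by simp
    qed
  next
    assume R: ?R
    have "\<exists>D. \<forall>x\<in>carrier_vec ?n. \<forall>\<epsilon>\<in>carrier_vec N.
        wt \<epsilon> \<le> \<delta> \<longrightarrow> D (E x + \<epsilon>) (subvec x (side_info H i)) = x $ demand H i"
      if i: "i < receivers H" for i
    proof -
      \<comment> \<open>\<open>C y s x\<close> says that the message \<open>x\<close> is consistent
        with the received word \<open>y\<close> and the side information \<open>s\<close>.\<close>
      define C where "C y s x \<longleftrightarrow> x \<in> carrier_vec ?n \<and> s = subvec x (side_info H i) \<and>
        (\<exists>\<epsilon>\<in>carrier_vec N. wt \<epsilon> \<le> \<delta> \<and> y = E x + \<epsilon>)" for y s x
      have unique: "x $ demand H i = x' $ demand H i" if C: "C y s x" "C y s x'" for y s x x'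
      proof -
        obtain \<epsilon> \<epsilon>' where \<epsilon>: "\<epsilon> \<in> carrier_vec N" "\<epsilon>' \<in> carrier_vec N" "wt \<epsilon> \<le> \<delta>" "wt \<epsilon>' \<le> \<delta>"
            "E x + \<epsilon> = E x' + \<epsilon>'"
          and x: "x \<in> carrier_vec ?n" "x' \<in> carrier_vec ?n"
            "subvec x (side_info H i) = subvec x' (side_info H i)"
          using C unfolding C_def by metis
        have Ex: "E x \<in> carrier_vec N" "E x' \<in> carrier_vec N"
          using E x LT by auto
        have "transpose_mat L *\<^sub>v (x - x') = E x - E x'"
          using mult_minus_distrib_mat_vec[OF LT x(1,2)] E x by simp
        also have "\<dots> = \<epsilon>' - \<epsilon>"
        proof (rule eq_vecI)
          fix j assume "j < dim_vec (\<epsilon>' - \<epsilon>)"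
          then have j: "j < N"
            using \<epsilon> by simp
          have "(E x + \<epsilon>) $ j = (E x' + \<epsilon>') $ j"
            using \<epsilon> by simp
          then show "(E x - E x') $ j = (\<epsilon>' - \<epsilon>) $ j"
            using \<epsilon>(1,2) Ex j by (simp add: algebra_simps)
        qed (use \<epsilon> Ex in auto)
        finally have "wt (transpose_mat L *\<^sub>v (x - x')) \<le> 2 * \<delta>"
          using wt_minus_le[OF \<epsilon>(2,1)] \<epsilon> by simp
        moreover have "\<forall>j\<in>side_info H i. (x - x') $ j = 0"
          using x side[OF i] by (auto simp: subvec_eq_iff)
        ultimately have "(x - x') $ demand H i = 0"
          using R i x by simp
        then show ?thesis
          using x side[OF i] by simp
      qed
      show ?thesis
      proof (intro exI ballI impI)
        fix x \<epsilon> :: "'a vec" assume "x \<in> carrier_vec ?n" "\<epsilon> \<in> carrier_vec N" "wt \<epsilon> \<le> \<delta>"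
        then have "C (E x + \<epsilon>) (subvec x (side_info H i)) x"
          by (auto simp: C_def)
        \<comment> \<open>The decoder picks any consistent message; by \<open>unique\<close> the
          choice does not affect the demanded entry.\<close>
        then show "(SOME x'. C (E x + \<epsilon>) (subvec x (side_info H i)) x') $ demand H i = x $ demand H i"
          using someI unique by metis
      qed
    qed
    moreover have "E \<in> carrier_vec ?n \<rightarrow> carrier_vec N"
      using E LT by auto
    ultimately show "ecic H \<delta> N E"
      by (simp add: ecic_def)
  qed
qed

section \<open>Codeword coordinates and attainment of the min-rank\<close>

lemma index_transpose_mult_vec:
  fixes L :: "'a::comm_semiring_0 mat"
  assumes "L \<in> carrier_mat n N" "z \<in> carrier_vec n" "s < N"
  shows "(transpose_mat L *\<^sub>v z) $ s = (\<Sum>j<n. z $ j * L $$ (j, s))"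
  using assms by (simp add: scalar_prod_def atLeast0LessThan mult.commute)

text \<open>The zero family is admissible, so the \<open>LEAST\<close> ranges over a nonempty set
  and is a value actually taken.\<close>

lemma min_rank_attained:
  obtains v :: "nat \<Rightarrow> 'a::field vec"
  where "\<And>i. i < receivers H \<Longrightarrow> v i \<in> carrier_vec (messages H) \<and> supp (v i) \<subseteq> side_info H i"
    and "min_rank TYPE('a) H = family_rank (messages H)
           (map (\<lambda>i. v i + unit_vec (messages H) (demand H i)) [0..<receivers H])"
proof -
  let ?P = "\<lambda>r. \<exists>v :: nat \<Rightarrow> 'a vec.
    (\<forall>i<receivers H. v i \<in> carrier_vec (messages H) \<and> supp (v i) \<subseteq> side_info H i) \<and>
    r = family_rank (messages H)
          (map (\<lambda>i. v i + unit_vec (messages H) (demand H i)) [0..<receivers H])"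
  have "\<exists>r. ?P r"
    by (intro exI[of _ "family_rank _ _"] exI[of _ "\<lambda>_. 0\<^sub>v (messages H)"]) (auto simp: supp_def)
  then have "?P (LEAST r. ?P r)"
    by (rule LeastI_ex)
  then show thesis
    using that unfolding min_rank_def by blast
qed

lemma min_rank_le:
  fixes v :: "nat \<Rightarrow> 'a::field vec"
  assumes "\<And>i. i < receivers H \<Longrightarrow> v i \<in> carrier_vec (messages H)"
    and "\<And>i. i < receivers H \<Longrightarrow> supp (v i) \<subseteq> side_info H i"
  shows "min_rank TYPE('a) H \<le> family_rank (messages H)
           (map (\<lambda>i. v i + unit_vec (messages H) (demand H i)) [0..<receivers H])"
  unfolding min_rank_def by (rule Least_le) (use assms in blast)

section \<open>Upper bound: a code of length kappa + 2 delta\<close>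

lemma linear_ecic_of_min_rank:
  assumes inst: "icsi_instance H"
    and q: "min_rank TYPE('a::{field,finite}) H + 2 * \<delta> \<le> CARD('a) + 1"
  shows "\<exists>E :: 'a vec \<Rightarrow> 'a vec. linear_ecic H \<delta> (min_rank TYPE('a) H + 2 * \<delta>) E"
proof -
  define n where "n = messages H"
  define \<kappa> where "\<kappa> = min_rank TYPE('a) H"
  define N where "N = \<kappa> + 2 * \<delta>"
  obtain v :: "nat \<Rightarrow> 'a vec"
    where v: "\<And>i. i < receivers H \<Longrightarrow> v i \<in> carrier_vec n \<and> supp (v i) \<subseteq> side_info H i"
      and \<kappa>: "\<kappa> = family_rank n (map (\<lambda>i. v i + unit_vec n (demand H i)) [0..<receivers H])"
    unfolding \<kappa>_def n_def using min_rank_attained[of H] by blast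
  define us where "us = map (\<lambda>i. v i + unit_vec n (demand H i)) [0..<receivers H]"
  have us: "set us \<subseteq> carrier_vec n"
    using v by (auto simp: us_def)
  have cols: "cols (mat_of_cols n us) = us"
    using us by simp
  have rank: "vec_space.rank n (mat_of_cols n us) = \<kappa>"
    by (simp add: \<kappa> us_def family_rank_def)
  have "\<exists>b c. \<forall>u\<in>set us. \<forall>j<n. u $ j = (\<Sum>t<\<kappa>. c u t * b t j)"
    using vec_space.rank_factorization[OF mat_of_cols_carrier(1)[of n us]] unfolding cols rank .
  then obtain b c where bc: "\<forall>u\<in>set us. \<forall>j<n. u $ j = (\<Sum>t<\<kappa>. c u t * b t j)"
    by (elim exE)
  have "N \<le> CARD('a) + 1"
    using q by (simp add: N_def \<kappa>_def)
  from extended_reed_solomon[OF this] obtain ev :: "nat \<Rightarrow> nat \<Rightarrow> 'a"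
    where ev: "\<forall>y. \<kappa> \<le> card {s. s < N \<and> (\<Sum>t<\<kappa>. y t * ev s t) = 0} \<longrightarrow> (\<forall>t<\<kappa>. y t = 0)" ..
  \<comment> \<open>Composite encoder: \<open>b\<close> compresses a message to \<kappa> symbols,
    and \<open>ev\<close> encodes these by the extended Reed-Solomon code.\<close>
  define L where "L = mat n N (\<lambda>(j, s). \<Sum>t<\<kappa>. b t j * ev s t)"
  have L: "L \<in> carrier_mat n N"
    by (simp add: L_def)
  have "z $ demand H i = 0"
    if i: "i < receivers H" and z: "z \<in> carrier_vec n" and z0: "\<forall>j\<in>side_info H i. z $ j = 0"
      and wt: "wt (transpose_mat L *\<^sub>v z) \<le> 2 * \<delta>" for i z
  proof -
    \<comment> \<open>The compressed form of \<open>z\<close>; its Reed-Solomon codeword is the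
      codeword of \<open>z\<close> under \<open>L\<close>.\<close>
    define y where "y t = (\<Sum>j<n. z $ j * b t j)" for t
    have Lz: "(transpose_mat L *\<^sub>v z) $ s = (\<Sum>t<\<kappa>. y t * ev s t)" if "s < N" for s
    proof -
      have "(transpose_mat L *\<^sub>v z) $ s = (\<Sum>j<n. \<Sum>t<\<kappa>. z $ j * b t j * ev s t)"
        unfolding index_transpose_mult_vec[OF L z that]
        using that by (intro sum.cong) (auto simp: L_def sum_distrib_left mult.assoc)
      also have "\<dots> = (\<Sum>t<\<kappa>. y t * ev s t)"
        by (subst sum.swap) (simp add: y_def sum_distrib_right)
      finally show ?thesis .
    qed
    have dim: "dim_vec (transpose_mat L *\<^sub>v z) = N"
      using L by simp
    have "{s. s < N \<and> (\<Sum>t<\<kappa>. y t * ev s t) = 0} = {..<N} - supp (transpose_mat L *\<^sub>v z)"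
      using Lz dim unfolding supp_def by auto
    moreover have "card ({..<N} - supp (transpose_mat L *\<^sub>v z)) \<ge> N - wt (transpose_mat L *\<^sub>v z)"
      unfolding wt_def using diff_card_le_card_Diff[of "supp (transpose_mat L *\<^sub>v z)" "{..<N}"] by simp
    \<comment> \<open>At most 2 \<delta> of the \<kappa> + 2 \<delta> coordinates are nonzero, which
      leaves enough zeros to force \<open>y\<close> to vanish.\<close>
    ultimately have "\<kappa> \<le> card {s. s < N \<and> (\<Sum>t<\<kappa>. y t * ev s t) = 0}"
      using wt by (simp add: N_def)
    then have y0: "y t = 0" if "t < \<kappa>" for t
      using ev that by blast
    define u where "u = v i + unit_vec n (demand H i)"
    have f: "demand H i < n"
      using inst i by (simp add: icsi_instance_def n_def)
    have "u \<in> set us"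
      using i by (auto simp: us_def u_def)
    \<comment> \<open>As \<open>u\<close> is a combination of the \<open>b t\<close>, its product
      with \<open>z\<close> is a combination of the entries of \<open>y\<close>.\<close>
    then have "(\<Sum>j<n. z $ j * u $ j) = (\<Sum>j<n. \<Sum>t<\<kappa>. c u t * (z $ j * b t j))"
      by (intro sum.cong) (auto simp: bc sum_distrib_left mult.left_commute)
    also have "\<dots> = (\<Sum>t<\<kappa>. c u t * y t)"
      by (subst sum.swap) (simp add: y_def sum_distrib_left)
    also have "\<dots> = 0"
      by (simp add: y0)
    finally have "(\<Sum>j<n. z $ j * u $ j) = 0" .
    \<comment> \<open>Only the demanded entry survives: \<open>v i\<close> is supported on the side
      information, where \<open>z\<close> is zero.\<close>
    moreover have "z $ j * u $ j = (if j = demand H i then z $ j else 0)" if "j < n" for j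
    proof -
      have "z $ j * v i $ j = 0"
        using v[OF i] z0 that by (auto simp: supp_def)
      then show ?thesis
        using v[OF i] f that by (auto simp: u_def algebra_simps)
    qed
    ultimately show ?thesis
      using f by simp
  qed
  then have "ecic H \<delta> N (\<lambda>x. transpose_mat L *\<^sub>v x)"
    using ecic_linear_iff[OF inst, of L N] L unfolding n_def by blast
  then show ?thesis
    using L unfolding linear_ecic_def n_def N_def \<kappa>_def by blast
qed

section \<open>Lower bound on the length\<close>

lemma linear_ecic_length_ge:
  fixes E :: "'a::field vec \<Rightarrow> 'a vec"
  assumes inst: "icsi_instance H" and E: "linear_ecic H \<delta> N E"
  shows "min_rank TYPE('a) H + 2 * \<delta> \<le> N"
proof -
  define n where "n = messages H"
  obtain L where L: "L \<in> carrier_mat n N"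
    and EL: "\<And>x. x \<in> carrier_vec n \<Longrightarrow> E x = transpose_mat L *\<^sub>v x"
    using E unfolding linear_ecic_def n_def by blast
  have R: "z $ demand H i = 0"
    if "i < receivers H" "z \<in> carrier_vec n" "\<forall>j\<in>side_info H i. z $ j = 0"
      "wt (transpose_mat L *\<^sub>v z) \<le> 2 * \<delta>" for i z
    using ecic_linear_iff[OF inst, of L N E \<delta>] L EL E that unfolding linear_ecic_def n_def by blast
  have side: "side_info H i \<subseteq> {..<n}" "demand H i < n" "demand H i \<notin> side_info H i"
    "finite (side_info H i)" if "i < receivers H" for i
    using inst that finite_subset unfolding icsi_instance_def n_def by auto
  \<comment> \<open>Keeps the natural subtraction \<open>N - 2 * \<delta>\<close> from truncating.
    Otherwise no word would weigh more than 2 \<delta>, and the unit vector at the demand of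
    receiver 0 would violate the criterion.\<close>
  have N: "2 * \<delta> < N"
  proof (rule ccontr)
    assume "\<not> 2 * \<delta> < N"
    moreover have "wt w \<le> N" if "dim_vec w = N" for w :: "'a vec"
      using that card_mono[of "{..<N}" "supp w"] by (auto simp: wt_def supp_def)
    ultimately have "wt (transpose_mat L *\<^sub>v unit_vec n (demand H 0)) \<le> 2 * \<delta>"
      using L by (metis carrier_matD(2) dim_mult_mat_vec index_transpose_mat(2) le_trans not_le)
    moreover have "0 < receivers H"
      using inst by (simp add: icsi_instance_def)
    moreover from this have "\<forall>j\<in>side_info H 0. unit_vec n (demand H 0) $ j = (0::'a)"
      using side by (fastforce simp: unit_vec_def)
    ultimately have "unit_vec n (demand H 0) $ demand H 0 = (0::'a)"
      using R by simp
    then show False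
      using side \<open>0 < receivers H\<close> by simp
  qed
  \<comment> \<open>The columns of \<open>L\<close> that remain after deleting the first 2
    \<delta>.\<close>
  define b where "b t j = L $$ (j, 2 * \<delta> + t)" for t j
  have "\<exists>v. v \<in> carrier_vec n \<and> supp v \<subseteq> side_info H i \<and>
      (\<exists>c. \<forall>j<n. (v + unit_vec n (demand H i)) $ j = (\<Sum>t<N - 2 * \<delta>. c t * b t j))"
    if i: "i < receivers H" for i
  proof -
    \<comment> \<open>The functionals for the duality step: \<open>Inl\<close> for the remaining
      columns, \<open>Inr\<close> for the coordinates in the side information.\<close>
    define I where "I = {..<N - 2 * \<delta>} <+> side_info H i"
    define g where "g k j = (case k of Inl t \<Rightarrow> b t j | Inr l \<Rightarrow> if j = l then 1 else 0)"
      for k :: "nat + nat" and j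
    have "(\<Sum>j<n. z j * (if j = demand H i then 1 else 0)) = 0"
      if z: "\<And>k. k \<in> I \<Longrightarrow> (\<Sum>j<n. z j * g k j) = 0" for z
    proof -
      have z0: "z l = 0" if "l \<in> side_info H i" for l
      proof -
        have "(\<Sum>j<n. z j * g (Inr l) j) = (\<Sum>j<n. if j = l then z j else 0)"
          by (intro sum.cong) (auto simp: g_def)
        then show ?thesis
          using z[of "Inr l", unfolded I_def, OF InrI[OF that]] that side(1)[OF i] by (auto simp: I_def)
      qed
      have "(transpose_mat L *\<^sub>v vec n z) $ s = 0" if s: "2 * \<delta> \<le> s" "s < N" for s
      proof -
        have "(\<Sum>j<n. z j * g (Inl (s - 2 * \<delta>)) j) = 0"
          using s by (intro z) (auto simp: I_def)
        then show ?thesis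
          using s by (simp add: index_transpose_mult_vec[OF L] g_def b_def)
      qed
      \<comment> \<open>The codeword lives on the deleted positions only, hence is too light for the
        demanded entry to be nonzero.\<close>
      then have "supp (transpose_mat L *\<^sub>v vec n z) \<subseteq> {..<2 * \<delta>}"
        using L unfolding supp_def by (auto simp: not_less[symmetric] simp del: index_mult_mat_vec)
      then have "wt (transpose_mat L *\<^sub>v vec n z) \<le> 2 * \<delta>"
        unfolding wt_def using card_mono[of "{..<2 * \<delta>}"] by fastforce
      then have "z (demand H i) = 0"
        using R[OF i vec_carrier] z0 side[OF i] by (simp add: subset_iff)
      then show ?thesis
        by (intro sum.neutral) auto
    qed
    then have "\<exists>c. \<forall>j<n. (if j = demand H i then 1 else 0) = (\<Sum>k\<in>I. c k * g k j)"
      using side(4)[OF i] by (intro combination_of_common_kernel) (simp_all add: I_def)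
    then obtain c where c: "\<And>j. j < n \<Longrightarrow> (if j = demand H i then 1 else 0) = (\<Sum>k\<in>I. c k * g k j)"
      by blast
    \<comment> \<open>Moving the coordinate part of the combination to the side of the unit vector
      gives \<open>v\<close>, hence the minus sign.\<close>
    define v where "v = vec n (\<lambda>j. if j \<in> side_info H i then - c (Inr j) else 0)"
    have "(v + unit_vec n (demand H i)) $ j = (\<Sum>t<N - 2 * \<delta>. c (Inl t) * b t j)" if j: "j < n" for j
    proof -
      have "(\<Sum>l\<in>side_info H i. c (Inr l) * g (Inr l) j) = (\<Sum>l\<in>side_info H i. if l = j then c (Inr j) else 0)"
        by (intro sum.cong) (auto simp: g_def)
      then have "(\<Sum>l\<in>side_info H i. c (Inr l) * g (Inr l) j) = - (v $ j)"
        using side(4)[OF i] j by (simp add: v_def)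
      then have "(if j = demand H i then 1 else 0) = (\<Sum>t<N - 2 * \<delta>. c (Inl t) * b t j) - v $ j"
        using c[OF j] side(4)[OF i] by (simp add: I_def sum.Plus g_def)
      then show ?thesis
        using j side(2)[OF i] by (auto simp: v_def unit_vec_def algebra_simps split: if_splits)
    qed
    moreover have "supp v \<subseteq> side_info H i"
      by (auto simp: supp_def v_def split: if_splits)
    ultimately show ?thesis
      by (intro exI[of _ v] conjI exI[of _ "\<lambda>t. c (Inl t)"]) (auto simp: v_def)
  qed
  then obtain v where v: "\<And>i. i < receivers H \<Longrightarrow> v i \<in> carrier_vec n"
    "\<And>i. i < receivers H \<Longrightarrow> supp (v i) \<subseteq> side_info H i"
    "\<And>i. i < receivers H \<Longrightarrow> \<exists>c. \<forall>j<n. (v i + unit_vec n (demand H i)) $ j = (\<Sum>t<N - 2 * \<delta>. c t * b t j)"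
    by metis
  define us where "us = map (\<lambda>i. v i + unit_vec n (demand H i)) [0..<receivers H]"
  have cols: "cols (mat_of_cols n us) = us"
    using v by (intro cols_mat_of_cols) (auto simp: us_def)
  \<comment> \<open>The columns \<open>b\<close> are shared by all receivers, so they span the whole
    family at once.\<close>
  have "vec_space.rank n (mat_of_cols n us) \<le> N - 2 * \<delta>"
  proof (rule vec_space.rank_le_factorization[OF mat_of_cols_carrier(1), where b = b], unfold cols)
    fix u assume "u \<in> set us"
    then obtain i where "i < receivers H" "u = v i + unit_vec n (demand H i)"
      by (auto simp: us_def)
    then show "\<exists>c. \<forall>j<n. u $ j = (\<Sum>t<N - 2 * \<delta>. c t * b t j)"
      using v(3) by blast
  qed
  then have "min_rank TYPE('a) H \<le> N - 2 * \<delta>"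
    using min_rank_le[of H v] v unfolding family_rank_def us_def n_def by fastforce
  then show ?thesis
    using N by simp
qed

theorem mainTheorem4:
  fixes H :: icsi and \<delta> :: nat
  assumes "icsi_instance H"
    and "int CARD('a) \<ge> int (min_rank TYPE('a::{field,finite}) H) + 2 * int \<delta> - 1"
  shows "opt_length TYPE('a) H \<delta> = min_rank TYPE('a) H + 2 * \<delta>"
  unfolding opt_length_def
proof (rule Least_equality)
  \<comment> \<open>Moving the 1 across turns the integer hypothesis into a bound on naturals by the
    number of projective points.\<close>
  have "min_rank TYPE('a) H + 2 * \<delta> \<le> CARD('a) + 1"
    using assms(2) by linarith
  then show "\<exists>E :: 'a vec \<Rightarrow> 'a vec. linear_ecic H \<delta> (min_rank TYPE('a) H + 2 * \<delta>) E"
    by (rule linear_ecic_of_min_rank[OF assms(1)])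
next
  fix N assume "\<exists>E :: 'a vec \<Rightarrow> 'a vec. linear_ecic H \<delta> N E"
  then show "min_rank TYPE('a) H + 2 * \<delta> \<le> N"
    using linear_ecic_length_ge[OF assms(1)] by blast
qed

end
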